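(* As formal power series in $x$ and $y$, $$\sum_{n\geq1}\sum_{k=0}^{n-1}T(n,k)\,x^ny^{k}=\sum_{n\geq 1} \frac{x^n}{(1-xy)^{\binom{n+1}{2}}},$$ where $T(n,k)$ is the number of partitions of $[n]$ with exactly $k$ arcs and no right nestings.
   Context: Write $[n]=\{1,2,\ldots,n\}$. A partition $\pi$ of $[n]$ (set partition into nonempty blocks) is represented by a diagram with vertices $1,\ldots,n$: for each block $B=\{i_1<i_2<\cdots<i_m\}$ one draws the arcs $(i_1,i_2),(i_2,i_3),\ldots,(i_{m-1},i_m)$; these are the arcs of $\pi$. A right nesting of $\pi$ is a pair of arcs $(i_1,j_1),(i_2,j_2)$ of $\pi$ with $i_1<i_2<j_2<j_1$ and $j_2+1=j_1$. *)

theory Defs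
  imports
    "HOL-Library.Disjoint_Sets"
    "HOL-Computational_Algebra.Formal_Power_Series"
begin

text \<open>
  The arcs of a partition \<open>P\<close> join consecutive elements of each block
  \<open>B = {i\<^sub>1 < \<dots> < i\<^sub>m}\<close>; the increasing list \<open>[i\<^sub>1, \<dots>, i\<^sub>m]\<close> is \<open>sorted_list_of_set B\<close>.
\<close>

definition arcs :: "nat set set \<Rightarrow> (nat \<times> nat) set" where
  "arcs P = {(sorted_list_of_set B ! r, sorted_list_of_set B ! Suc r) | B r.
               B \<in> P \<and> Suc r < card B}"

definition right_nestings :: "nat set set \<Rightarrow> ((nat \<times> nat) \<times> (nat \<times> nat)) set" where
  "right_nestings P = {((i1, j1), (i2, j2)) | i1 j1 i2 j2.
     (i1, j1) \<in> arcs P \<and> (i2, j2) \<in> arcs P \<and> i1 < i2 \<and> i2 < j2 \<and> j2 < j1 \<and> j2 + 1 = j1}"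

definition T :: "nat \<Rightarrow> nat \<Rightarrow> nat" where
  "T n k = card {P. partition_on {1..n} P \<and> card (arcs P) = k \<and> right_nestings P = {}}"

text \<open>
  Power series in \<open>X\<close> and \<open>Y\<close> are power series in \<open>X\<close> whose coefficients are power series
  in \<open>Y\<close>. Convergence in this type is \<open>X\<close>-adic.
\<close>

abbreviation X :: "rat fps fps" where "X \<equiv> fps_X"

abbreviation Y :: "rat fps fps" where "Y \<equiv> fps_const fps_X"

text \<open>
  The coefficient ring of the outer series is not a field, so most library facts on division
  of power series do not apply. Division by a power of \<open>1 - X * Y\<close> is nevertheless genuine.
\<close>

lemma divide_one_minus_XY_power:
  fixes a :: "rat fps fps"
  shows "a / (1 - X * Y) ^ m * (1 - X * Y) ^ m = a"
proof -
  let ?g = "(1 - X * Y) ^ m"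
  have g0: "fps_nth ?g 0 = 1"
    by (simp add: fps_power_zeroth)
  then have sd: "subdegree ?g = 0"
    by (intro subdegree_eq_0) simp
  then have uf: "unit_factor ?g = ?g"
    by simp
  have "fps_nth ?g 0 * inverse (fps_nth ?g 0) = 1"
    unfolding g0 by (simp add: inverse_mult_eq_1')
  then have "?g * inverse ?g = 1"
    unfolding fps_inverse_def[of ?g] by (rule fps_right_inverse)
  then show ?thesis
    unfolding fps_divide_def uf sd by (simp add: mult.assoc mult.commute[of "inverse ?g"])
qed

end

theory Submission
  imports Defs
begin

text \<open>
  A partition has a right nesting iff two consecutive right endpoints \<open>j\<close>, \<open>j + 1\<close> of arcs have
  decreasing left endpoints. Build a partition of \<open>[n]\<close> by inserting \<open>1, 2, \<dots>, n\<close> in turn. While \<open>m\<close>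
  blocks are present, each element of a run of non-minimal elements is appended to a block whose
  current maximum exceeds the left endpoint chosen just before. The numbers of blocks still available
  along such a run of length \<open>c\<close> form an arbitrary weakly decreasing sequence in \<open>{1..m}\<close>, so the
  run contributes the coefficient of \<open>z\<^sup>c\<close> in \<open>(1 - z)\<^sup>-\<^sup>m\<close>. Over all runs this gives
  \<open>\<Prod>\<^sub>t\<^sub>\<le>\<^sub>m (1 - z)\<^sup>-\<^sup>t\<close>, the exponents adding up to \<open>(m + 1) choose 2\<close>. Instead of manipulating products,
  the closed form of the coefficients is verified by induction, refined by the number of available blocks.
\<close>

section \<open>Blocks, arcs and right nestings of a partition of \<open>{1..n}\<close>\<close>

lemma block_subset:
  assumes "partition_on {1..n::nat} P" "B \<in> P"
  shows "B \<subseteq> {1..n}"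
  using assms by (metis Union_upper partition_onD1)

lemma finite_block:
  assumes "partition_on {1..n::nat} P" "B \<in> P"
  shows "finite B"
  using block_subset[OF assms] finite_subset by blast

lemma block_nonempty: "partition_on A P \<Longrightarrow> B \<in> P \<Longrightarrow> B \<noteq> {}"
  using partition_onD3 by blast

lemma block_unique:
  assumes "partition_on A P" "B \<in> P" "C \<in> P" "x \<in> B" "x \<in> C"
  shows "B = C"
  using assms by (metis IntI disjointD empty_iff partition_onD2)

text \<open>Adjacency without list indices, so that arcs are easily followed when a new maximum
  joins a block.\<close>

definition arc_in :: "nat set \<Rightarrow> nat \<Rightarrow> nat \<Rightarrow> bool" where
  "arc_in B i j \<longleftrightarrow> i \<in> B \<and> j \<in> B \<and> i < j \<and> B \<inter> {i<..<j} = {}"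

text \<open>The sorted list increases strictly, so entries with nothing of \<open>B\<close> between
  them stand at adjacent positions.\<close>

lemma arc_in_iff_nth:
  assumes "finite B"
  shows "arc_in B i j \<longleftrightarrow>
    (\<exists>r. Suc r < card B \<and> i = sorted_list_of_set B ! r \<and> j = sorted_list_of_set B ! Suc r)"
proof -
  define s where "s = sorted_list_of_set B"
  have len: "length s = card B" and set: "set s = B"
    using assms by (simp_all add: s_def)
  have less_iff: "s ! p < s ! q \<longleftrightarrow> p < q" if "p < card B" "q < card B" for p q
  proof -
    have "sorted_wrt (<) s"
      by (simp add: s_def)
    then show ?thesis
      using that len by (metis linorder_neqE_nat order_less_asym sorted_wrt_nth_less)
  qed
  have mem_iff: "x \<in> B \<longleftrightarrow> (\<exists>p<card B. x = s ! p)" for x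
    using len set by (metis in_set_conv_nth)
  have "arc_in B i j \<longleftrightarrow> (\<exists>r. Suc r < card B \<and> i = s ! r \<and> j = s ! Suc r)"
  proof
    assume arc: "arc_in B i j"
    then obtain p q where pq: "p < card B" "i = s ! p" "q < card B" "j = s ! q"
      unfolding arc_in_def mem_iff by blast
    with arc have "p < q"
      using less_iff arc_in_def by simp
    moreover have "\<not> Suc p < q"
    proof
      assume "Suc p < q"
      then have "s ! Suc p \<in> B \<inter> {i<..<j}"
        using pq less_iff[of p "Suc p"] less_iff[of "Suc p" q] by (auto simp: mem_iff intro: less_trans)
      with arc show False
        unfolding arc_in_def by blast
    qed
    ultimately have "q = Suc p"
      by simp
    with pq show "\<exists>r. Suc r < card B \<and> i = s ! r \<and> j = s ! Suc r"
      by blast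
  next
    assume "\<exists>r. Suc r < card B \<and> i = s ! r \<and> j = s ! Suc r"
    then obtain r where r: "Suc r < card B" "i = s ! r" "j = s ! Suc r"
      by blast
    have "x \<notin> {i<..<j}" if x: "x \<in> B" for x
    proof -
      obtain p where "p < card B" "x = s ! p"
        using x mem_iff by blast
      then show ?thesis
        using r less_iff[of r p] less_iff[of p "Suc r"] by auto
    qed
    moreover have "i \<in> B" "j \<in> B"
      using r mem_iff Suc_lessD by blast+
    moreover have "i < j"
      using r less_iff[of r "Suc r"] by simp
    ultimately show "arc_in B i j"
      unfolding arc_in_def by blast
  qed
  then show ?thesis
    by (simp add: s_def)
qed

lemma arcs_iff:
  assumes "partition_on {1..n} P"
  shows "(i, j) \<in> arcs P \<longleftrightarrow> (\<exists>B\<in>P. arc_in B i j)"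
  using arc_in_iff_nth finite_block[OF assms] unfolding arcs_def by fastforce

lemma arcs_bounds:
  assumes "partition_on {1..n} P" "(i, j) \<in> arcs P"
  shows "i < j" "j \<le> n"
  using assms(2) block_subset[OF assms(1)] by (fastforce simp: arcs_iff[OF assms(1)] arc_in_def)+

lemma finite_arcs:
  assumes "partition_on {1..n} P"
  shows "finite (arcs P)"
proof (rule finite_subset)
  show "arcs P \<subseteq> {..n} \<times> {..n}"
    using arcs_bounds[OF assms] by fastforce
qed simp

text \<open>\<open>i2 < j2\<close> holds for every arc and \<open>j2 < j1\<close> follows from
  \<open>j2 + 1 = j1\<close>, so only the order of the left endpoints remains to be tested.\<close>

lemma right_nestings_empty_iff:
  assumes "partition_on {1..n} P"
  shows "right_nestings P = {} \<longleftrightarrow>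
    (\<forall>i1 i2 j. (i1, Suc j) \<in> arcs P \<longrightarrow> (i2, j) \<in> arcs P \<longrightarrow> i2 \<le> i1)"
proof
  assume *: "right_nestings P = {}"
  show "\<forall>i1 i2 j. (i1, Suc j) \<in> arcs P \<longrightarrow> (i2, j) \<in> arcs P \<longrightarrow> i2 \<le> i1"
  proof (intro allI impI, rule ccontr)
    fix i1 i2 j
    assume a: "(i1, Suc j) \<in> arcs P" "(i2, j) \<in> arcs P" "\<not> i2 \<le> i1"
    then have "((i1, Suc j), (i2, j)) \<in> right_nestings P"
      using arcs_bounds[OF assms a(2)] by (simp add: right_nestings_def)
    with * show False
      by simp
  qed
next
  assume *: "\<forall>i1 i2 j. (i1, Suc j) \<in> arcs P \<longrightarrow> (i2, j) \<in> arcs P \<longrightarrow> i2 \<le> i1"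
  show "right_nestings P = {}"
    unfolding right_nestings_def using * by force
qed

section \<open>Inserting \<open>Suc n\<close> into a partition of \<open>{1..n}\<close>\<close>

definition append_to :: "nat \<Rightarrow> nat set \<Rightarrow> nat set set \<Rightarrow> nat set set" where
  "append_to n B Q = insert (insert (Suc n) B) (Q - {B})"

text \<open>The blocks of \<open>P\<close> to which \<open>n + 1\<close> can be appended without creating a right nesting.\<close>

definition avail :: "nat \<Rightarrow> nat set set \<Rightarrow> nat set set" where
  "avail n P = {B \<in> P. \<forall>i. (i, n) \<in> arcs P \<longrightarrow> i < Max B}"

lemma partition_on_insert_singleton:
  assumes "partition_on {1..n} Q"
  shows "partition_on {1..Suc n} (insert {Suc n} Q)"
proof -
  have "partition_on (insert (Suc n) {1..n}) (insert {Suc n} Q)"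
    using assms by (subst partition_on_insert) (auto simp: disjnt_def partition_onD1[OF assms, symmetric])
  then show ?thesis
    by (simp add: atLeastAtMostSuc_conv)
qed

lemma partition_on_append_to:
  assumes Q: "partition_on {1..n} Q" and B: "B \<in> Q"
  shows "partition_on {1..Suc n} (append_to n B Q)"
proof -
  have U: "\<Union>Q = {1..n}"
    using Q partition_onD1 by blast
  have sub: "C \<subseteq> {1..n}" if "C \<in> Q" for C
    using Q that by (rule block_subset)
  show ?thesis
  proof (rule partition_onI)
    show "\<Union>(append_to n B Q) = {1..Suc n}"
    proof -
      have "\<Union>(append_to n B Q) = insert (Suc n) (\<Union>Q)"
        using B by (auto simp: append_to_def)
      then show ?thesis
        by (simp add: U atLeastAtMostSuc_conv)
    qed
    have disj: "disjnt C D" if "C \<in> Q" "D \<in> Q" "C \<noteq> D" for C D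
      using that block_unique[OF Q] by (auto simp: disjnt_def)
    have new: "disjnt (insert (Suc n) B) D" if "D \<in> Q - {B}" for D
      using that disj[of B D] B sub[of D] by (auto simp: disjnt_insert1)
    show "disjnt C D" if "C \<in> append_to n B Q" "D \<in> append_to n B Q" "C \<noteq> D" for C D
      using that new disj disjnt_sym unfolding append_to_def by blast
    show "{} \<notin> append_to n B Q"
      using partition_onD3[OF Q] by (simp add: append_to_def)
  qed
qed

text \<open>Delete \<open>Suc n\<close> from its block \<open>C\<close>: either nothing is left, or
  the remainder \<open>B\<close> is a block of a partition of \<open>{1..n}\<close>.\<close>

lemma partition_on_Suc_cases:
  assumes P: "partition_on {1..Suc n} P"
  obtains Q where "partition_on {1..n} Q" "P = insert {Suc n} Q"
  | Q B where "partition_on {1..n} Q" "B \<in> Q" "P = append_to n B Q"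
proof -
  have "Suc n \<in> \<Union>P"
    using partition_onD1[OF P] by auto
  then obtain C where C: "C \<in> P" "Suc n \<in> C"
    by blast
  define B where "B = C - {Suc n}"
  have CB: "C = insert (Suc n) B" and nB: "Suc n \<notin> B"
    using C by (auto simp: B_def)
  have rest: "partition_on ({1..Suc n} - C) (P - {C})"
  proof (rule partition_onI)
    show "\<Union>(P - {C}) = {1..Suc n} - C"
      using partition_onD1[OF P] block_unique[OF P C(1)] by auto
    show "disjnt D E" if "D \<in> P - {C}" "E \<in> P - {C}" "D \<noteq> E" for D E
      using that block_unique[OF P] by (auto simp: disjnt_def)
    show "{} \<notin> P - {C}"
      using partition_onD3[OF P] by simp
  qed
  have Bsub: "B \<subseteq> {1..n}"
    using block_subset[OF P C(1)] nB by (auto simp: CB le_Suc_eq)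
  show thesis
  proof (cases "B = {}")
    case True
    have "{1..Suc n} - C = {1..n}"
      using CB True by auto
    with rest have "partition_on {1..n} (P - {C})"
      by simp
    moreover have "P = insert {Suc n} (P - {C})"
      using C CB True by auto
    ultimately show thesis
      using that(1) by blast
  next
    case False
    have eq: "{1..n} - B = {1..Suc n} - C"
      using CB by auto
    have "partition_on {1..n} (insert B (P - {C}))"
    proof (subst partition_on_insert)
      show "disjnt B (\<Union>(P - {C}))"
        using partition_onD1[OF rest] CB by (auto simp: disjnt_def)
      show "partition_on ({1..n} - B) (P - {C}) \<and> B \<subseteq> {1..n} \<and> B \<noteq> {}"
        using rest eq False Bsub by auto
    qed
    \<comment> \<open>Otherwise the removal of \<open>B\<close> inside \<open>append_to\<close>
      would lose a block of \<open>P\<close>.\<close>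
    moreover have "B \<notin> P"
      using False block_unique[OF P C(1), of B] CB nB by blast
    then have "P = append_to n B (insert B (P - {C}))"
      using C CB by (auto simp: append_to_def)
    ultimately show thesis
      using that(2) by blast
  qed
qed

lemma singleton_notin:
  assumes "partition_on {1..n} Q"
  shows "{Suc n} \<notin> Q"
  using block_subset[OF assms, of "{Suc n}"] by auto

lemma singleton_notin_append_to:
  assumes Q: "partition_on {1..n} Q" and B: "B \<in> Q"
  shows "{Suc n} \<notin> append_to n B Q"
proof -
  have "B \<noteq> {}" "Suc n \<notin> B"
    using block_nonempty[OF Q B] block_subset[OF Q B] by auto
  then show ?thesis
    using singleton_notin[OF Q] by (auto simp: append_to_def)
qed

text \<open>Only one block contains \<open>Suc n\<close>; stripping \<open>Suc n\<close> from it
  recovers \<open>B\<close>, and the remaining blocks then determine \<open>Q\<close>.\<close>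

lemma append_to_inject:
  assumes Q: "partition_on {1..n} Q" "B \<in> Q" and Q': "partition_on {1..n} Q'" "B' \<in> Q'"
    and eq: "append_to n B Q = append_to n B' Q'"
  shows "B = B' \<and> Q = Q'"
proof -
  have fresh: "Suc n \<notin> C" if "C \<in> Q \<or> C \<in> Q'" for C
    using that block_subset[OF Q(1)] block_subset[OF Q'(1)] by fastforce
  have "insert (Suc n) B \<in> append_to n B' Q'"
    using eq by (auto simp: append_to_def)
  then have "insert (Suc n) B = insert (Suc n) B'"
    using fresh by (auto simp: append_to_def)
  then have BB: "B = B'"
    using fresh Q Q' by (metis insert_ident)
  have "Q - {B} = append_to n B Q - {insert (Suc n) B}" "Q' - {B'} = append_to n B' Q' - {insert (Suc n) B'}"
    using fresh by (auto simp: append_to_def)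
  then have "Q - {B} = Q' - {B}"
    using eq BB by simp
  with BB Q Q' show ?thesis
    by blast
qed

text \<open>\<open>Suc n\<close> lies above all of \<open>B\<close>: it separates no old pair, and
  only \<open>Max B\<close> has nothing of \<open>B\<close> above it.\<close>

lemma arc_in_insert_Suc:
  assumes "B \<subseteq> {1..n}" "B \<noteq> {}"
  shows "arc_in (insert (Suc n) B) i j \<longleftrightarrow> arc_in B i j \<or> i = Max B \<and> j = Suc n"
proof -
  have fin: "finite B"
    using assms finite_subset by blast
  have le: "x \<le> n" if "x \<in> B" for x
    using assms that by auto
  have M: "Max B \<in> B" "\<And>x. x \<in> B \<Longrightarrow> x \<le> Max B"
    using fin assms by auto
  show ?thesis
  proof (cases "j = Suc n")
    case True
    have "arc_in (insert (Suc n) B) i (Suc n) \<longleftrightarrow> i = Max B"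
    proof
      assume "arc_in (insert (Suc n) B) i (Suc n)"
      then have "i \<in> B" and "Max B \<notin> {i<..<Suc n}"
        using M(1) by (auto simp: arc_in_def)
      then show "i = Max B"
        using M le[of "Max B"] by fastforce
    next
      assume "i = Max B"
      then show "arc_in (insert (Suc n) B) i (Suc n)"
        using M le by (fastforce simp: arc_in_def)
    qed
    moreover have "\<not> arc_in B i (Suc n)"
      using le[of "Suc n"] by (auto simp: arc_in_def)
    ultimately show ?thesis
      using True by blast
  next
    case False
    then show ?thesis
      using le by (fastforce simp: arc_in_def)
  qed
qed

lemma arcs_insert_singleton:
  assumes Q: "partition_on {1..n} Q"
  shows "arcs (insert {Suc n} Q) = arcs Q"
proof -
  have "(i, j) \<in> arcs (insert {Suc n} Q) \<longleftrightarrow> (i, j) \<in> arcs Q" for i j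
    unfolding arcs_iff[OF Q] arcs_iff[OF partition_on_insert_singleton[OF Q]]
    by (auto simp: arc_in_def)
  then show ?thesis
    by auto
qed

lemma arcs_append_to:
  assumes Q: "partition_on {1..n} Q" and B: "B \<in> Q"
  shows "arcs (append_to n B Q) = insert (Max B, Suc n) (arcs Q)"
proof -
  have "(i, j) \<in> arcs (append_to n B Q) \<longleftrightarrow> (i, j) \<in> insert (Max B, Suc n) (arcs Q)" for i j
    using arc_in_insert_Suc[OF block_subset[OF Q B] block_nonempty[OF Q B]] B
    unfolding insert_iff arcs_iff[OF Q] arcs_iff[OF partition_on_append_to[OF Q B]]
    by (auto simp: append_to_def)
  then show ?thesis
    by auto
qed

lemma card_insert_singleton:
  assumes Q: "partition_on {1..n} Q"
  shows "card (insert {Suc n} Q) = Suc (card Q)"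
  using singleton_notin[OF Q] finite_elements[OF _ Q] by simp

lemma insert_Suc_notin:
  assumes "partition_on {1..n} Q"
  shows "insert (Suc n) B \<notin> Q"
  using block_subset[OF assms, of "insert (Suc n) B"] by auto

lemma card_append_to:
  assumes Q: "partition_on {1..n} Q" and B: "B \<in> Q"
  shows "card (append_to n B Q) = card Q"
proof -
  have fin: "finite Q"
    using finite_elements[OF _ Q] by simp
  then have "card Q > 0"
    using B card_gt_0_iff by blast
  then show ?thesis
    using insert_Suc_notin[OF Q, of B] fin B by (simp add: append_to_def)
qed

text \<open>Each insertion creates either one block or one arc. Prescribing \<open>k\<close> arcs
  therefore amounts to prescribing \<open>n - k\<close> blocks.\<close>

lemma card_arcs_add_card:
  assumes "partition_on {1..n} P"
  shows "card (arcs P) + card P = n"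
  using assms
proof (induction n arbitrary: P)
  case 0
  then have "P = {}"
    by (simp add: partition_on_empty)
  then show ?case
    by (simp add: arcs_def)
next
  case (Suc n)
  from Suc.prems show ?case
  proof (cases rule: partition_on_Suc_cases)
    case (1 Q)
    then show ?thesis
      using Suc.IH[of Q] by (simp add: arcs_insert_singleton card_insert_singleton)
  next
    case (2 Q B)
    have "(Max B, Suc n) \<notin> arcs Q"
      using arcs_bounds[OF 2(1)] by fastforce
    then show ?thesis
      using 2 Suc.IH[of Q] finite_arcs[OF 2(1)] by (simp add: arcs_append_to card_append_to)
  qed
qed

lemma right_nestings_insert_singleton:
  assumes Q: "partition_on {1..n} Q"
  shows "right_nestings (insert {Suc n} Q) = right_nestings Q"
  by (simp add: right_nestings_def arcs_insert_singleton[OF Q])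

text \<open>The new arc \<open>(Max B, Suc n)\<close> can nest only over an arc ending at
  \<open>n\<close>. Absence of nestings gives \<open>i \<le> Max B\<close>, while
  \<open>avail\<close> asks for \<open><\<close>; equality would put \<open>n\<close> into
  \<open>B\<close> above its maximum.\<close>

lemma right_nestings_append_to:
  assumes Q: "partition_on {1..n} Q" and B: "B \<in> Q"
  shows "right_nestings (append_to n B Q) = {} \<longleftrightarrow> right_nestings Q = {} \<and> B \<in> avail n Q"
proof -
  have neq: "i \<noteq> Max B" if i: "(i, n) \<in> arcs Q" for i
  proof
    assume "i = Max B"
    moreover have "Max B \<in> B"
      using finite_block[OF Q B] block_nonempty[OF Q B] by simp
    moreover obtain C where "C \<in> Q" "i \<in> C" "n \<in> C" "i < n"
      using i by (auto simp: arcs_iff[OF Q] arc_in_def)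
    ultimately have "n \<in> B"
      using block_unique[OF Q B] by blast
    then have "n \<le> Max B"
      using finite_block[OF Q B] by simp
    with \<open>i = Max B\<close> \<open>i < n\<close> show False
      by simp
  qed
  \<comment> \<open>Hence the new arc is never the inner one: an outer arc would have to end at
    \<open>Suc (Suc n)\<close>.\<close>
  have top: "(i, Suc n) \<notin> arcs Q" "(i, Suc (Suc n)) \<notin> arcs Q" for i
    using arcs_bounds[OF Q] by fastforce+
  have "right_nestings (append_to n B Q) = {} \<longleftrightarrow>
      right_nestings Q = {} \<and> (\<forall>i. (i, n) \<in> arcs Q \<longrightarrow> i \<le> Max B)"
    unfolding right_nestings_empty_iff[OF Q] right_nestings_empty_iff[OF partition_on_append_to[OF Q B]]
      arcs_append_to[OF Q B]
    using top by (simp only: insert_iff prod.inject) blast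
  also have "\<dots> \<longleftrightarrow> right_nestings Q = {} \<and> B \<in> avail n Q"
    using neq B by (auto simp: avail_def order_le_less)
  finally show ?thesis .
qed

lemma avail_subset: "avail n P \<subseteq> P"
  by (auto simp: avail_def)

text \<open>No arc ends at \<open>Suc n\<close>, so the condition in \<open>avail\<close> is
  void.\<close>

lemma avail_insert_singleton:
  assumes Q: "partition_on {1..n} Q"
  shows "avail (Suc n) (insert {Suc n} Q) = insert {Suc n} Q"
  using arcs_bounds(2)[OF Q] by (fastforce simp: avail_def arcs_insert_singleton[OF Q])

text \<open>The arc ending at \<open>Suc n\<close> now starts at \<open>Max B\<close>. The enlarged
  block qualifies through its maximum \<open>Suc n\<close>, whence the \<open>Suc\<close>; every
  other block beyond \<open>Max B\<close> was available already because \<open>B\<close>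
  was.\<close>

lemma avail_append_to:
  assumes Q: "partition_on {1..n} Q" and B: "B \<in> avail n Q"
  shows "card (avail (Suc n) (append_to n B Q)) = Suc (card {C \<in> avail n Q. Max B < Max C})"
proof -
  have BQ: "B \<in> Q"
    using B avail_subset by blast
  have top: "(i, Suc n) \<notin> arcs Q" for i
    using arcs_bounds[OF Q] by fastforce
  have fin: "finite B" and ne: "B \<noteq> {}"
    using finite_block[OF Q BQ] block_nonempty[OF Q BQ] by auto
  have "Max B \<le> n"
    using block_subset[OF Q BQ] fin ne by auto
  then have "Max B < Max (insert (Suc n) B)"
    using fin ne by (simp only: Max_insert less_max_iff_disj less_Suc_eq_le simp_thms)
  then have "avail (Suc n) (append_to n B Q) = insert (insert (Suc n) B) {C \<in> Q. Max B < Max C}"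
    using top unfolding avail_def arcs_append_to[OF Q BQ] by (auto simp: append_to_def)
  also have "{C \<in> Q. Max B < Max C} = {C \<in> avail n Q. Max B < Max C}"
    using B by (fastforce simp: avail_def)
  moreover have "finite (avail n Q)"
    using finite_elements[OF _ Q] avail_subset finite_subset by blast
  moreover have "insert (Suc n) B \<notin> avail n Q"
    using insert_Suc_notin[OF Q] avail_subset by blast
  ultimately show ?thesis
    by simp
qed

section \<open>Ranking the available blocks and the recursion for partitions without right
  nestings\<close>

lemma inj_on_Max:
  assumes Q: "partition_on {1..n::nat} Q"
  shows "inj_on Max Q"
proof (rule inj_onI)
  fix B C
  assume "B \<in> Q" "C \<in> Q" "Max B = Max C"
  then show "B = C"
    using block_unique[OF Q] Max_in finite_block[OF Q] block_nonempty[OF Q] by metis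
qed

text \<open>Numbering \<open>A\<close> from the largest value of \<open>f\<close> downwards is a
  bijection onto \<open>{1..card A}\<close>: it strictly reverses the order, and its values fit into
  that range.\<close>

lemma sum_rank:
  fixes f :: "'a \<Rightarrow> 'b::linorder"
  assumes fin: "finite A" and inj: "inj_on f A"
  shows "(\<Sum>x\<in>A. h (Suc (card {y \<in> A. f x < f y}))) = (\<Sum>b=1..card A. h b)"
proof -
  define r where "r x = Suc (card {y \<in> A. f x < f y})" for x
  have mono: "r y < r x" if "x \<in> A" "y \<in> A" "f x < f y" for x y
  proof -
    have "{z \<in> A. f y < f z} \<subset> {z \<in> A. f x < f z}"
      using that by auto
    then show ?thesis
      using fin by (simp add: r_def psubset_card_mono)
  qed
  have injr: "inj_on r A"
    using mono inj by (metis (no_types, lifting) inj_on_def less_irrefl linorder_neqE)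
  have "r x \<le> card A" if "x \<in> A" for x
  proof -
    have "{y \<in> A. f x < f y} \<subset> A"
      using that by auto
    then show ?thesis
      using fin by (simp add: r_def psubset_card_mono Suc_leI)
  qed
  then have "r ` A \<subseteq> {1..card A}"
    by (auto simp: r_def)
  then have "r ` A = {1..card A}"
    using card_image[OF injr] by (simp add: card_subset_eq)
  then show ?thesis
    using sum.reindex[OF injr, of h] by (simp add: r_def o_def)
qed

definition nonnesting :: "nat \<Rightarrow> nat set set set" where
  "nonnesting n = {P. partition_on {1..n} P \<and> right_nestings P = {}}"

lemma finite_nonnesting: "finite (nonnesting n)"
  using finitely_many_partition_on[of "{1..n}"] by (auto simp: nonnesting_def intro: rev_finite_subset)

text \<open>Deleting the largest element creates no right nesting, so every such partition arises by
  insertion from a smaller one.\<close>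

lemma nonnesting_Suc:
  "nonnesting (Suc n) = insert {Suc n} ` nonnesting n \<union>
     (\<lambda>(Q, B). append_to n B Q) ` (SIGMA Q:nonnesting n. avail n Q)"
  (is "?L = ?R")
proof
  show "?L \<subseteq> ?R"
  proof
    fix P
    assume "P \<in> ?L"
    then have P: "partition_on {1..Suc n} P" "right_nestings P = {}"
      by (auto simp: nonnesting_def)
    from P(1) show "P \<in> ?R"
    proof (cases rule: partition_on_Suc_cases)
      case (1 Q)
      then show ?thesis
        using P(2) by (auto simp: nonnesting_def right_nestings_insert_singleton)
    next
      case (2 Q B)
      then have "Q \<in> nonnesting n" "B \<in> avail n Q"
        using P(2) by (auto simp: nonnesting_def right_nestings_append_to)
      with 2(3) show ?thesis
        by force
    qed
  qed
  show "?R \<subseteq> ?L"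
  proof -
    have "insert {Suc n} Q \<in> ?L" if "Q \<in> nonnesting n" for Q
      using that partition_on_insert_singleton right_nestings_insert_singleton
      by (simp add: nonnesting_def)
    moreover have "append_to n B Q \<in> ?L" if "Q \<in> nonnesting n" "B \<in> avail n Q" for Q B
    proof -
      have "B \<in> Q"
        using that avail_subset by blast
      then show ?thesis
        using that partition_on_append_to right_nestings_append_to by (simp add: nonnesting_def)
    qed
    ultimately show ?thesis
      by auto
  qed
qed

text \<open>
  Appending \<open>n + 1\<close> to the available block with the \<open>b\<close>-th largest maximum leaves exactly \<open>b\<close>
  available blocks, so a partition with \<open>a\<close> available blocks has one child for each \<open>b \<le> a\<close>.
\<close>

lemma sum_nonnesting_Suc:
  fixes g :: "nat \<Rightarrow> nat \<Rightarrow> 'a::comm_monoid_add"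
  shows "(\<Sum>P\<in>nonnesting (Suc n). g (card P) (card (avail (Suc n) P))) =
    (\<Sum>Q\<in>nonnesting n. g (Suc (card Q)) (Suc (card Q)) + (\<Sum>b=1..card (avail n Q). g (card Q) b))"
proof -
  define F where "F P = g (card P) (card (avail (Suc n) P))" for P
  let ?E = "SIGMA Q:nonnesting n. avail n Q"
  have part: "partition_on {1..n} Q" if "Q \<in> nonnesting n" for Q
    using that by (simp add: nonnesting_def)
  have finQ: "finite (avail n Q)" if "Q \<in> nonnesting n" for Q
    using finite_elements[OF _ part[OF that]] avail_subset finite_subset by blast
  have inj1: "inj_on (insert {Suc n}) (nonnesting n)"
    using singleton_notin[OF part] by (intro inj_onI) (metis insert_ident)
  have inj2: "inj_on (\<lambda>(Q, B). append_to n B Q) ?E"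
  proof (rule inj_onI, clarify)
    fix Q B Q' B'
    assume "Q \<in> nonnesting n" "Q' \<in> nonnesting n" "B \<in> avail n Q" "B' \<in> avail n Q'"
      and eq: "append_to n B Q = append_to n B' Q'"
    then have "partition_on {1..n} Q" "partition_on {1..n} Q'" "B \<in> Q" "B' \<in> Q'"
      using part avail_subset by blast+
    then show "Q = Q' \<and> B = B'"
      using append_to_inject eq by blast
  qed
  have disj: "insert {Suc n} ` nonnesting n \<inter> (\<lambda>(Q, B). append_to n B Q) ` ?E = {}"
    using singleton_notin_append_to[OF part] avail_subset[THEN subsetD] by auto (metis insertI1)
  have "(\<Sum>P\<in>nonnesting (Suc n). F P) =
      (\<Sum>Q\<in>nonnesting n. F (insert {Suc n} Q)) + (\<Sum>(Q, B)\<in>?E. F (append_to n B Q))"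
    unfolding nonnesting_Suc using finite_nonnesting finQ disj
    by (subst sum.union_disjoint) (auto simp: sum.reindex[OF inj1] sum.reindex[OF inj2] prod.case_distrib)
  also have "(\<Sum>(Q, B)\<in>?E. F (append_to n B Q)) =
      (\<Sum>Q\<in>nonnesting n. \<Sum>B\<in>avail n Q. F (append_to n B Q))"
    using finite_nonnesting finQ by (subst sum.Sigma) auto
  also have "\<dots> = (\<Sum>Q\<in>nonnesting n. \<Sum>b=1..card (avail n Q). g (card Q) b)"
  proof (rule sum.cong[OF refl])
    fix Q
    assume Q: "Q \<in> nonnesting n"
    have "(\<Sum>B\<in>avail n Q. F (append_to n B Q)) =
        (\<Sum>B\<in>avail n Q. g (card Q) (Suc (card {C \<in> avail n Q. Max B < Max C})))"
      using avail_subset[of n Q]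
      by (intro sum.cong) (auto simp: F_def avail_append_to[OF part[OF Q]] card_append_to[OF part[OF Q]] subset_iff)
    then show "(\<Sum>B\<in>avail n Q. F (append_to n B Q)) = (\<Sum>b=1..card (avail n Q). g (card Q) b)"
      using sum_rank[OF finQ[OF Q], of Max "g (card Q)"] inj_on_Max[OF part[OF Q]] avail_subset
      by (metis inj_on_subset)
  qed
  also have "(\<Sum>Q\<in>nonnesting n. F (insert {Suc n} Q)) =
      (\<Sum>Q\<in>nonnesting n. g (Suc (card Q)) (Suc (card Q)))"
    using part by (intro sum.cong)
      (auto simp: F_def avail_insert_singleton card_insert_singleton)
  finally show ?thesis
    by (simp add: F_def sum.distrib)
qed

section \<open>Counts refined by available blocks, and their closed form\<close>

definition count_avail :: "nat \<Rightarrow> nat \<Rightarrow> nat \<Rightarrow> nat" where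
  "count_avail n m b = card {P \<in> nonnesting n. card P = m \<and> b \<le> card (avail n P)}"

definition count_avail_eq :: "nat \<Rightarrow> nat \<Rightarrow> nat \<Rightarrow> nat" where
  "count_avail_eq n m b = card {P \<in> nonnesting n. card P = m \<and> card (avail n P) = b}"

lemma count_avail_Suc: "count_avail n m b = count_avail n m (Suc b) + count_avail_eq n m b"
proof -
  have "{P \<in> nonnesting n. card P = m \<and> b \<le> card (avail n P)} =
      {P \<in> nonnesting n. card P = m \<and> Suc b \<le> card (avail n P)} \<union>
      {P \<in> nonnesting n. card P = m \<and> card (avail n P) = b}"
    by auto
  then show ?thesis
    unfolding count_avail_def count_avail_eq_def
    using finite_nonnesting by (simp, subst card_Un_disjoint) auto
qed

text \<open>A new singleton makes all \<open>m\<close> blocks available. Otherwise a parent has one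
  child with exactly \<open>b > 0\<close> available blocks iff it has at least \<open>b\<close>
  itself, which is why \<open>count_avail\<close> is cumulative.\<close>

lemma count_avail_eq_Suc:
  "count_avail_eq (Suc n) m b =
    (if b = m \<and> 0 < m then count_avail n (m - 1) 0 else 0) + (if 0 < b then count_avail n m b else 0)"
proof -
  have card_sum: "card {P \<in> nonnesting n. p P} = (\<Sum>P\<in>nonnesting n. if p P then 1 else 0)" for p n
    using finite_nonnesting by (simp add: sum.inter_filter[symmetric])
  have "count_avail_eq (Suc n) m b = (\<Sum>Q\<in>nonnesting n. (if Suc (card Q) = m \<and> Suc (card Q) = b then 1 else 0)
      + (\<Sum>b'=1..card (avail n Q). if card Q = m \<and> b' = b then 1 else 0))"
    unfolding count_avail_eq_def card_sum by (rule sum_nonnesting_Suc)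
  also have "\<dots> = (\<Sum>Q\<in>nonnesting n. (if b = m \<and> 0 < m \<and> card Q = m - 1 then 1 else 0)
      + (if 0 < b \<and> card Q = m \<and> b \<le> card (avail n Q) then 1 else 0))"
  proof (rule sum.cong[OF refl], rule arg_cong2[of _ _ _ _ "(+)"])
    fix Q
    show "(\<Sum>b'=1..card (avail n Q). if card Q = m \<and> b' = b then 1 else 0) =
        (if 0 < b \<and> card Q = m \<and> b \<le> card (avail n Q) then 1 else (0::nat))"
      by (cases "card Q = m") (auto simp: Suc_le_eq)
  qed auto
  also have "\<dots> = (if b = m \<and> 0 < m then count_avail n (m - 1) 0 else 0) + (if 0 < b then count_avail n m b else 0)"
    unfolding sum.distrib card_sum[symmetric] count_avail_def by auto
  finally show ?thesis .
qed

lemma nonnesting_bounds: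
  assumes "P \<in> nonnesting n"
  shows "card P \<le> n" "card (avail n P) \<le> card P" "0 < n \<Longrightarrow> 0 < card P"
proof -
  have P: "partition_on {1..n} P"
    using assms by (simp add: nonnesting_def)
  have fin: "finite P"
    using finite_elements[OF _ P] by simp
  show "card P \<le> n"
    using card_arcs_add_card[OF P] by simp
  show "card (avail n P) \<le> card P"
    by (rule card_mono[OF fin avail_subset])
  show "0 < card P" if "0 < n"
    using that fin partition_onD1[OF P] by (auto simp: card_gt_0_iff)
qed

lemma count_avail_eq_0:
  assumes "m < b \<or> n < m \<or> (m = 0 \<and> 0 < n)"
  shows "count_avail n m b = 0"
proof -
  have "{P \<in> nonnesting n. card P = m \<and> b \<le> card (avail n P)} = {}"
    using assms nonnesting_bounds[of _ n] by fastforce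
  then show ?thesis
    by (simp only: count_avail_def card.empty)
qed

lemma count_avail_0_0_0: "count_avail 0 0 0 = 1"
proof -
  have "nonnesting 0 = {{}}"
    by (auto simp: nonnesting_def partition_on_empty right_nestings_def arcs_def)
  then show ?thesis
    by (simp add: count_avail_def cong: conj_cong)
qed

text \<open>For \<open>0 < n\<close> the block containing \<open>n\<close> is always available; the
  empty partition is the exception.\<close>

lemma count_avail_0:
  assumes "0 < n"
  shows "count_avail n m 0 = count_avail n m 1"
proof -
  obtain n' where "n = Suc n'"
    using assms gr0_implies_Suc by blast
  then show ?thesis
    using count_avail_Suc[of n m 0] count_avail_eq_Suc[of n' m 0] by simp
qed

lemma choose_two_Suc: "Suc m choose 2 = (m choose 2) + m"
  by (simp add: numeral_2_eq_2)

text \<open>The right side is the coefficient of \<open>z^k\<close> in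
  \<open>(1 - z)^-((m choose 2) + d + 1)\<close>. The outer induction is on the number of points,
  the inner one on \<open>d\<close>; the recursion for the counts becomes Pascal's rule.\<close>

lemma count_avail_closed_form:
  assumes "d < m"
  shows "count_avail (m + k) m (m - d) = ((m choose 2) + d + k) choose k"
  using assms
proof (induction "m + k" arbitrary: m k d rule: less_induct)
  case less
  define n where "n = m + k - 1"
  have n: "m + k = Suc n"
    using less.prems by (simp add: n_def)
  have prev: "count_avail n m (m - d) = (if k = 0 then 0 else ((m choose 2) + d + (k - 1)) choose (k - 1))"
    if "d < m" for d
  proof (cases k)
    case 0
    then show ?thesis
      using n by (simp add: count_avail_eq_0)
  next
    case (Suc k')
    then have "n = m + k'"
      using n by simp
    then show ?thesis
      using less.hyps[of m k' d] that Suc by simp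
  qed
  show ?case
    unfolding n using less.prems
  proof (induction d)
    case 0
    have "count_avail (Suc n) m m = count_avail n (m - 1) 0 + count_avail n m m"
      using 0 count_avail_Suc[of "Suc n" m m] count_avail_eq_Suc[of n m m]
      by (simp add: count_avail_eq_0)
    also have "\<dots> = ((m choose 2) + k) choose k"
    proof (cases "m = 1")
      \<comment> \<open>Before its only block was opened, the partition was empty.\<close>
      case True
      then have "n = k"
        using n by simp
      then have "count_avail n (m - 1) 0 = (if k = 0 then 1 else 0)"
        using True by (simp add: count_avail_0_0_0 count_avail_eq_0)
      then show ?thesis
        using prev[of 0] True by (simp add: numeral_2_eq_2)
    next
      case False
      then obtain p where p: "m = Suc (Suc p)"
        using 0 by (metis One_nat_def gr0_implies_Suc not0_implies_Suc)
      have np: "n = Suc p + k"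
        using n p by simp
      \<comment> \<open>The threshold 0 may be replaced by 1, that is \<open>d = p\<close>. The
        upper entry is then one below \<open>(m choose 2) + k\<close>, as Pascal's rule
        requires.\<close>
      have "count_avail n (m - 1) 0 = ((Suc p choose 2) + p + k) choose k"
        using less.hyps[of "Suc p" k p] count_avail_0[of n "Suc p"] np p by simp
      then show ?thesis
        using prev[of 0] p by (cases k) (simp_all add: choose_two_Suc)
    qed
    finally show ?case
      by simp
  next
    case (Suc d)
    have "Suc (m - Suc d) = m - d" "m - Suc d \<noteq> m"
      using Suc.prems by simp_all
    then have "count_avail (Suc n) m (m - Suc d) = count_avail (Suc n) m (m - d) + count_avail n m (m - Suc d)"
      using Suc.prems count_avail_Suc[of "Suc n" m "m - Suc d"] count_avail_eq_Suc[of n m "m - Suc d"]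
      by simp
    also have "\<dots> = ((m choose 2) + Suc d + k) choose k"
      using Suc prev[of "Suc d"] by (cases k) simp_all
    finally show ?case .
  qed
qed

text \<open>\<open>k\<close> arcs on \<open>m + k\<close> points mean \<open>m\<close> blocks.
  Imposing no condition on availability equals threshold 1, thus \<open>d = m - 1\<close>.\<close>

lemma T_closed_form:
  assumes "0 < m"
  shows "T (m + k) k = ((Suc m choose 2) + k - 1) choose k"
proof -
  have "{P. partition_on {1..m + k} P \<and> card (arcs P) = k \<and> right_nestings P = {}} =
      {P \<in> nonnesting (m + k). card P = m}"
    using card_arcs_add_card[of "m + k"] by (fastforce simp: nonnesting_def)
  then have "T (m + k) k = count_avail (m + k) m 0"
    by (simp add: T_def count_avail_def)
  also have "\<dots> = count_avail (m + k) m (m - (m - 1))"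
    using assms by (simp add: count_avail_0)
  also have "\<dots> = ((m choose 2) + (m - 1) + k) choose k"
    using assms by (subst count_avail_closed_form) auto
  also have "(m choose 2) + (m - 1) + k = (Suc m choose 2) + k - 1"
    using assms by (simp add: choose_two_Suc)
  finally show ?thesis .
qed

section \<open>Power series: convergence and comparison of coefficients\<close>

lemma sums_fpsI:
  fixes f :: "nat \<Rightarrow> 'a::comm_ring_1 fps"
  assumes "\<And>m i. i < m \<Longrightarrow> fps_nth (f m) i = 0"
  shows "f sums Abs_fps (\<lambda>i. \<Sum>m\<le>i. fps_nth (f m) i)"
  unfolding sums_def
proof (rule tendsto_fpsI)
  fix i
  \<comment> \<open>Coefficient \<open>i\<close> receives nothing from \<open>f m\<close> with
    \<open>m > i\<close>, so it is constant once \<open>i < n\<close>.\<close>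
  have "fps_nth (\<Sum>m<n. f m) i = (\<Sum>m\<le>i. fps_nth (f m) i)" if "i < n" for n
    unfolding fps_sum_nth using that assms by (intro sum.mono_neutral_right) auto
  then show "\<forall>\<^sub>F n in sequentially. fps_nth (\<Sum>m<n. f m) i =
      fps_nth (Abs_fps (\<lambda>i. \<Sum>m\<le>i. fps_nth (f m) i)) i"
    unfolding eventually_sequentially fps_nth_Abs_fps by (meson Suc_le_eq)
qed

text \<open>The expansion of \<open>(1 - X * Y)^-e\<close>. Truncated subtraction is harmless at
  \<open>e = 0\<close>: \<open>0 choose 0\<close> is 1, and \<open>(j - 1) choose j\<close> is 0 for
  positive \<open>j\<close>.\<close>

definition neg_binomial :: "nat \<Rightarrow> rat fps fps" where
  "neg_binomial e = Abs_fps (\<lambda>j. of_nat ((e + j - 1) choose j) * fps_X ^ j)"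

text \<open>Multiplying by \<open>1 - X * Y\<close> lowers \<open>e\<close> by one; in each
  coefficient this is Pascal's rule.\<close>

lemma neg_binomial_mult: "neg_binomial e * (1 - X * Y) ^ e = 1"
proof (induction e)
  case 0
  have "fps_nth (neg_binomial 0) j = fps_nth 1 j" for j
    by (cases j) (simp_all add: neg_binomial_def)
  then show ?case
    by (simp add: fps_eq_iff)
next
  case (Suc e)
  have "fps_nth (neg_binomial (Suc e) * (1 - X * Y)) j = fps_nth (neg_binomial e) j" for j
  proof (cases j)
    case 0
    then show ?thesis
      by (simp add: neg_binomial_def)
  next
    case (Suc i)
    have "neg_binomial (Suc e) * (1 - X * Y) = neg_binomial (Suc e) - X * (Y * neg_binomial (Suc e))"
      by (simp add: algebra_simps)
    then show ?thesis
      using Suc by (simp add: neg_binomial_def algebra_simps)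
  qed
  then have "neg_binomial (Suc e) * (1 - X * Y) = neg_binomial e"
    by (simp add: fps_eq_iff)
  then show ?case
    using Suc.IH by (simp add: mult.assoc[symmetric])
qed

lemma divide_one_minus_XY_power_eq: "a / (1 - X * Y) ^ e = a * neg_binomial e"
proof -
  have "a / (1 - X * Y) ^ e = a / (1 - X * Y) ^ e * (neg_binomial e * (1 - X * Y) ^ e)"
    by (simp add: neg_binomial_mult)
  also have "\<dots> = (a / (1 - X * Y) ^ e * (1 - X * Y) ^ e) * neg_binomial e"
    by (simp only: ac_simps)
  also have "\<dots> = a * neg_binomial e"
    by (simp only: divide_one_minus_XY_power)
  finally show ?thesis .
qed

theorem theorem1p4:
  shows "summable (\<lambda>m. let n = Suc m in \<Sum>k = 0..n - 1. of_nat (T n k) * X ^ n * Y ^ k)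
       \<and> summable (\<lambda>m. let n = Suc m in X ^ n / (1 - X * Y) ^ ((n + 1) choose 2))
       \<and> (\<Sum>m. let n = Suc m in \<Sum>k = 0..n - 1. of_nat (T n k) * X ^ n * Y ^ k)
         = (\<Sum>m. let n = Suc m in X ^ n / (1 - X * Y) ^ ((n + 1) choose 2))"
proof -
  define f :: "nat \<Rightarrow> rat fps fps" where
    "f = (\<lambda>m. let n = Suc m in \<Sum>k = 0..n - 1. of_nat (T n k) * X ^ n * Y ^ k)"
  define g :: "nat \<Rightarrow> rat fps fps" where
    "g = (\<lambda>m. let n = Suc m in X ^ n / (1 - X * Y) ^ ((n + 1) choose 2))"
  have f_nth: "fps_nth (f m) i = (if i = Suc m then \<Sum>k=0..m. of_nat (T i k) * fps_X ^ k else 0)" for m i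
  proof -
    have "of_nat c * X ^ n * Y ^ k = X ^ n * fps_const (of_nat c * fps_X ^ k)" for c n k
      by (simp add: fps_of_nat[symmetric] mult_ac flip: fps_const_mult)
    then have "fps_nth (of_nat c * X ^ n * Y ^ k) i = (if i = n then of_nat c * fps_X ^ k else 0)" for c n k
      by (simp add: fps_X_power_mult_nth)
    then show ?thesis
      by (simp add: f_def fps_sum_nth del: power_Suc)
  qed
  have g_nth: "fps_nth (g m) i = (if i < Suc m then 0
      else of_nat (((Suc (Suc m) choose 2) + (i - Suc m) - 1) choose (i - Suc m)) * fps_X ^ (i - Suc m))" for m i
    by (simp add: g_def divide_one_minus_XY_power_eq fps_X_power_mult_nth neg_binomial_def del: power_Suc)
  have f_sums: "f sums Abs_fps (\<lambda>i. \<Sum>m\<le>i. fps_nth (f m) i)"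
    by (rule sums_fpsI) (simp add: f_nth)
  have g_sums: "g sums Abs_fps (\<lambda>i. \<Sum>m\<le>i. fps_nth (g m) i)"
    by (rule sums_fpsI) (simp add: g_nth)
  have "(\<Sum>m\<le>i. fps_nth (f m) i) = (\<Sum>m\<le>i. fps_nth (g m) i)" for i
  proof (cases i)
    case 0
    then show ?thesis
      by (simp add: f_nth g_nth)
  next
    case (Suc p)
    have "(\<Sum>m\<le>i. fps_nth (f m) i) = (\<Sum>k\<le>p. of_nat (T (Suc p) k) * fps_X ^ k)"
      using Suc by (simp add: f_nth atLeast0AtMost)
    \<comment> \<open>With \<open>k\<close> arcs on \<open>Suc p\<close> points there are
      \<open>Suc (p - k)\<close> blocks, the exponent of \<open>X\<close> in the numerator of
      \<open>g (p - k)\<close>.\<close>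
    also have "\<dots> = (\<Sum>k\<le>p. fps_nth (g (p - k)) i)"
    proof (rule sum.cong[OF refl])
      fix k
      assume "k \<in> {..p}"
      moreover from this have "\<not> p < p - k"
        by simp
      ultimately show "of_nat (T (Suc p) k) * fps_X ^ k = fps_nth (g (p - k)) i"
        using T_closed_form[of "Suc (p - k)" k] Suc by (simp add: g_nth)
    qed
    also have "\<dots> = (\<Sum>m\<le>p. fps_nth (g m) i)"
      by (rule sum.nat_diff_reindex[of "\<lambda>m. fps_nth (g m) i" "Suc p", unfolded lessThan_Suc_atMost, simplified])
    \<comment> \<open>The extra term \<open>m = i\<close> vanishes, since \<open>g i\<close> starts
      in \<open>X\<close>-degree \<open>Suc i\<close>.\<close>
    also have "\<dots> = (\<Sum>m\<le>i. fps_nth (g m) i)"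
      using Suc by (simp add: g_nth)
    finally show ?thesis .
  qed
  then have "f sums suminf g"
    using f_sums g_sums by (simp add: sums_iff)
  then have "summable f \<and> summable g \<and> suminf f = suminf g"
    using g_sums by (simp add: sums_iff)
  then show ?thesis
    by (simp only: f_def g_def)
qed

end
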